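(* In the approval voting situation, the margin-based variant of the CLC method results in a full qualitative compatibility between the rank-like rates $R_x$ and the (relative) approval scores $\alpha_x$: for all $x,y\in A$, $$R_x<R_y\iff \alpha_x>\alpha_y .$$
   Context: Let $A$ be a finite set of $N$ options and $\Pi=\{(x,y)\in A\times A : x\neq y\}$; a pair $(x,y)$ is written $xy$. Let $\Omega=\{v\in[0,1]^{\Pi} : v_{xy}+v_{yx}\le 1 \text{ for all } xy\in\Pi\}$; its elements are called Llull matrices. For $v\in\Omega$ put $t_{xy}=v_{xy}+v_{yx}$ (turnouts). Approval voting: each vote is a subset $X\subseteq A$ of approved options; $v_X\ge0$ denotes the fraction of votes approving exactly the set $X$, with $\sum_{X\subseteq A}v_X=1$. The relative approval score of $x$ is $\alpha_x=\sum_{X\ni x}v_X$. The margin-based variant interprets each approval vote as a complete comparison in which approved options are preferred to non-approved ones, approved options are tied with each other, and non-approved options are tied with each other; thus the Llull matrix is $$v_{xy}=\sum_{X\ni x,\,X\not\ni y}v_X+\tfrac12\sum_{X\ni x,\,X\ni y}v_X+\tfrac12\sum_{X\not\ni x,\,X\not\ni y}v_X ,$$ which satisfies $v_{xy}+v_{yx}=1$; the rates $R_x$ are then obtained by applying to this $v$ the following CLC procedure. CLC procedure applied to $v\in\Omega$: (1) Indirect scores: $v^*_{xy}=\max\min_{0\le i<n} v_{x_ix_{i+1}}$, the maximum being over all paths $x_0x_1\dots x_n$ ($n\ge1$, consecutive elements distinct) in $A$ with $x_0=x$, $x_n=y$. Indirect margins: $m^{\kappa}_{xy}=v^*_{xy}-v^*_{yx}$.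 (2) Indirect comparison relation: $\kappa=\{xy\in\Pi : m^{\kappa}_{xy}>0\}$ (it is transitive). An admissible order is any strict total order $\xi\subseteq\Pi$ on $A$ with $\kappa\subseteq\xi$. Fix an admissible order $\xi$. Write $x\succ_\xi y$ for $xy\in\xi$, and $x\succeq_\xi y$ for ($xy\in\xi$ or $x=y$). For $x$ not last in $\xi$, $x'$ denotes the immediate successor of $x$ in $\xi$ (the element following $x$). (3) For each non-last $x$: $m^{\sigma}_{xx'}=\min\{m^{\kappa}_{pq} : p\succeq_\xi x,\ x'\succeq_\xi q\}$. (4) $(t^{\sigma}_{xy})$ is the unique minimizer of $\sum_{x}\sum_{y\neq x}(\tau_{xy}-t_{xy})^2$ over all $\tau\in\mathbb{R}^{\Pi}$ satisfying: $\tau_{xy}=\tau_{yx}$ for all $xy\in\Pi$; $m^{\sigma}_{xx'}\le\tau_{xx'}\le1$ for all non-last $x$; and $0\le\tau_{xz}-\tau_{x'z}\le m^{\sigma}_{xx'}$ for all non-last $x$ and all $z\notin\{x,x'\}$. (5) Projected scores: $v^{\pi}_{xx'}=(t^{\sigma}_{xx'}+m^{\sigma}_{xx'})/2$, $v^{\pi}_{x'x}=(t^{\sigma}_{xx'}-m^{\sigma}_{xx'})/2$, and for $x\succ_\xi y$: $v^{\pi}_{xy}=\max\{v^{\pi}_{pp'} : x\succeq_\xi p\succ_\xi y\}$, $v^{\pi}_{yx}=\min\{v^{\pi}_{p'p} : x\succeq_\xi p\succ_\xi y\}$. (6) Rank-like rates: $R_x=N-\sum_{y\neq x}v^{\pi}_{xy}$.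 The projected scores and rank-like rates do not depend on the choice of the admissible order $\xi$, so they are functions of $v$. *)

theory Defs
  imports Complex_Main "HOL-Library.FuncSet"
begin

text \<open>
  A matrix on the option set \<open>A\<close> is a function \<open>v\<close> on pairs, \<open>v (x, y)\<close> being the score of \<open>x\<close>
  against \<open>y\<close>. Only its values on \<open>opairs A\<close> matter.
\<close>

definition opairs :: "'a set \<Rightarrow> ('a \<times> 'a) set" where
  "opairs A = {(x, y) \<in> A \<times> A. x \<noteq> y}"

definition llull_matrix :: "'a set \<Rightarrow> ('a \<times> 'a \<Rightarrow> real) \<Rightarrow> bool" where
  "llull_matrix A v \<longleftrightarrow>
     (\<forall>(x, y) \<in> opairs A. 0 \<le> v (x, y) \<and> v (x, y) \<le> 1 \<and> v (x, y) + v (y, x) \<le> 1)"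

definition turnout :: "('a \<times> 'a \<Rightarrow> real) \<Rightarrow> 'a \<times> 'a \<Rightarrow> real" where
  "turnout v = (\<lambda>(x, y). v (x, y) + v (y, x))"


subsection \<open>Indirect scores and admissible orders\<close>

definition paths :: "'a set \<Rightarrow> 'a \<Rightarrow> 'a \<Rightarrow> 'a list set" where
  "paths A x y = {xs. set xs \<subseteq> A \<and> 2 \<le> length xs \<and> successively (\<noteq>) xs \<and> hd xs = x \<and> last xs = y}"

text \<open>Paths may revisit options, so \<open>paths A x y\<close> is infinite in general; the set of their strengths
  is finite, being contained in the image of \<open>opairs A\<close> under \<open>v\<close>.\<close>

definition path_strength :: "('a \<times> 'a \<Rightarrow> real) \<Rightarrow> 'a list \<Rightarrow> real" where
  "path_strength v xs = Min {v (xs ! i, xs ! Suc i) | i. Suc i < length xs}"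

definition indirect_score :: "'a set \<Rightarrow> ('a \<times> 'a \<Rightarrow> real) \<Rightarrow> 'a \<times> 'a \<Rightarrow> real" where
  "indirect_score A v = (\<lambda>(x, y). Max (path_strength v ` paths A x y))"

definition indirect_margin :: "'a set \<Rightarrow> ('a \<times> 'a \<Rightarrow> real) \<Rightarrow> 'a \<times> 'a \<Rightarrow> real" where
  "indirect_margin A v = (\<lambda>(x, y). indirect_score A v (x, y) - indirect_score A v (y, x))"

definition indirect_comparison :: "'a set \<Rightarrow> ('a \<times> 'a \<Rightarrow> real) \<Rightarrow> 'a rel" where
  "indirect_comparison A v = {p \<in> opairs A. indirect_margin A v p > 0}"

definition admissible_order :: "'a set \<Rightarrow> ('a \<times> 'a \<Rightarrow> real) \<Rightarrow> 'a rel \<Rightarrow> bool" where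
  "admissible_order A v \<xi> \<longleftrightarrow>
     \<xi> \<subseteq> opairs A \<and> strict_linear_order_on A \<xi> \<and> indirect_comparison A v \<subseteq> \<xi>"

text \<open>\<open>consecutive \<xi> x x'\<close> says that \<open>x\<close> is not last in \<open>\<xi>\<close> and \<open>x'\<close> is its immediate successor.
  The weak order is the reflexive closure \<open>\<xi>\<^sup>=\<close>.\<close>

definition consecutive :: "'a rel \<Rightarrow> 'a \<Rightarrow> 'a \<Rightarrow> bool" where
  "consecutive \<xi> x x' \<longleftrightarrow> (x, x') \<in> \<xi> \<and> (\<nexists>z. (x, z) \<in> \<xi> \<and> (z, x') \<in> \<xi>)"


subsection \<open>Projected scores and rank-like rates\<close>

definition projected_margin ::
  "'a set \<Rightarrow> ('a \<times> 'a \<Rightarrow> real) \<Rightarrow> 'a rel \<Rightarrow> 'a \<times> 'a \<Rightarrow> real" where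
  "projected_margin A v \<xi> =
     (\<lambda>(x, x'). Min {indirect_margin A v (p, q) | p q. (p, x) \<in> \<xi>\<^sup>= \<and> (x', q) \<in> \<xi>\<^sup>=})"

text \<open>Elements of $\mathbb{R}^\Pi$ are taken to be extensional functions on \<open>opairs A\<close>, so that
  uniqueness of the minimizer is uniqueness as a function.\<close>

definition feasible_turnouts ::
  "'a set \<Rightarrow> ('a \<times> 'a \<Rightarrow> real) \<Rightarrow> 'a rel \<Rightarrow> ('a \<times> 'a \<Rightarrow> real) set" where
  "feasible_turnouts A v \<xi> = {\<tau> \<in> extensional (opairs A).
     (\<forall>(x, y) \<in> opairs A. \<tau> (x, y) = \<tau> (y, x)) \<and>
     (\<forall>x x'. consecutive \<xi> x x' \<longrightarrow>
        projected_margin A v \<xi> (x, x') \<le> \<tau> (x, x') \<and> \<tau> (x, x') \<le> 1 \<and>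
        (\<forall>z \<in> A - {x, x'}.
           0 \<le> \<tau> (x, z) - \<tau> (x', z) \<and> \<tau> (x, z) - \<tau> (x', z) \<le> projected_margin A v \<xi> (x, x')))}"

definition projected_turnout ::
  "'a set \<Rightarrow> ('a \<times> 'a \<Rightarrow> real) \<Rightarrow> 'a rel \<Rightarrow> 'a \<times> 'a \<Rightarrow> real" where
  "projected_turnout A v \<xi> =
     (THE \<tau>. is_arg_min (\<lambda>\<tau>. \<Sum>x\<in>A. \<Sum>y\<in>A - {x}. (\<tau> (x, y) - turnout v (x, y))\<^sup>2)
               (\<lambda>\<tau>. \<tau> \<in> feasible_turnouts A v \<xi>) \<tau>)"

text \<open>For consecutive \<open>x\<close>, \<open>x'\<close> the maximum and the minimum below range over the single step
  \<open>p = x\<close>, \<open>p' = x'\<close>, so the general formula includes that of the consecutive case.\<close>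

definition projected_score ::
  "'a set \<Rightarrow> ('a \<times> 'a \<Rightarrow> real) \<Rightarrow> 'a rel \<Rightarrow> 'a \<times> 'a \<Rightarrow> real" where
  "projected_score A v \<xi> = (\<lambda>(x, y).
     if (x, y) \<in> \<xi>
     then Max {(projected_turnout A v \<xi> (p, p') + projected_margin A v \<xi> (p, p')) / 2 | p p'.
                 consecutive \<xi> p p' \<and> (x, p) \<in> \<xi>\<^sup>= \<and> (p, y) \<in> \<xi>}
     else Min {(projected_turnout A v \<xi> (p, p') - projected_margin A v \<xi> (p, p')) / 2 | p p'.
                 consecutive \<xi> p p' \<and> (y, p) \<in> \<xi>\<^sup>= \<and> (p, x) \<in> \<xi>})"

definition rank_like_rate ::
  "'a set \<Rightarrow> ('a \<times> 'a \<Rightarrow> real) \<Rightarrow> 'a rel \<Rightarrow> 'a \<Rightarrow> real" where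
  "rank_like_rate A v \<xi> x = real (card A) - (\<Sum>y\<in>A - {x}. projected_score A v \<xi> (x, y))"


subsection \<open>Approval voting\<close>

text \<open>\<open>w X\<close> is the fraction of votes approving exactly the set \<open>X\<close>.\<close>

definition approval_profile :: "'a set \<Rightarrow> ('a set \<Rightarrow> real) \<Rightarrow> bool" where
  "approval_profile A w \<longleftrightarrow> (\<forall>X \<in> Pow A. 0 \<le> w X) \<and> (\<Sum>X\<in>Pow A. w X) = 1"

definition approval_score :: "'a set \<Rightarrow> ('a set \<Rightarrow> real) \<Rightarrow> 'a \<Rightarrow> real" where
  "approval_score A w x = (\<Sum>X | X \<subseteq> A \<and> x \<in> X. w X)"

definition approval_margin_matrix :: "'a set \<Rightarrow> ('a set \<Rightarrow> real) \<Rightarrow> 'a \<times> 'a \<Rightarrow> real" where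
  "approval_margin_matrix A w = (\<lambda>(x, y).
     (\<Sum>X | X \<subseteq> A \<and> x \<in> X \<and> y \<notin> X. w X)
     + 1 / 2 * (\<Sum>X | X \<subseteq> A \<and> x \<in> X \<and> y \<in> X. w X)
     + 1 / 2 * (\<Sum>X | X \<subseteq> A \<and> x \<notin> X \<and> y \<notin> X. w X))"


subsection \<open>Basic facts\<close>

lemma approval_margin_matrix_turnout:
  assumes "finite A" "approval_profile A w"
  shows "turnout (approval_margin_matrix A w) (x, y) = 1"
proof -
  have f: "finite (Pow A)" using assms by simp
  have S: "(\<Sum>X | X \<subseteq> A \<and> P X. w X) = (\<Sum>X\<in>Pow A. if P X then w X else 0)" for P
    using sum.inter_filter[OF f, of w P] by (simp add: Pow_def)
  have "turnout (approval_margin_matrix A w) (x, y) = (\<Sum>X\<in>Pow A. w X)"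
    unfolding turnout_def approval_margin_matrix_def
    by (simp add: S sum_distrib_left flip: sum.distrib) (intro sum.cong, auto)
  then show ?thesis using assms by (simp add: approval_profile_def)
qed

lemma llull_matrix_approval_margin_matrix:
  assumes "finite A" "approval_profile A w"
  shows "llull_matrix A (approval_margin_matrix A w)"
proof -
  have nn: "0 \<le> approval_margin_matrix A w (x, y)" for x y
    using assms unfolding approval_margin_matrix_def approval_profile_def
    by (auto intro!: add_nonneg_nonneg sum_nonneg)
  have "approval_margin_matrix A w (x, y) + approval_margin_matrix A w (y, x) = 1" for x y
    using approval_margin_matrix_turnout[OF assms, of x y] by (simp add: turnout_def)
  then show ?thesis
    unfolding llull_matrix_def using nn by (smt (verit) case_prodI2)
qed

lemma finite_steps: "finite {f i | i. Suc i < n}"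
proof -
  have "{f i | i. Suc i < n} = f ` {i. Suc i < n}" by auto
  moreover have "finite {i. Suc i < n}" by (rule finite_subset[of _ "{..<n}"]) auto
  ultimately show ?thesis by simp
qed

lemma path_strength_mem:
  assumes "xs \<in> paths A x y"
  shows "path_strength v xs \<in> v ` opairs A"
proof -
  let ?S = "{v (xs ! i, xs ! Suc i) | i. Suc i < length xs}"
  have l: "2 \<le> length xs" using assms by (simp add: paths_def)
  have "Suc 0 < length xs" using l by simp
  then have ne: "?S \<noteq> {}" by blast
  have "Min ?S \<in> ?S" by (rule Min_in[OF finite_steps ne])
  moreover have "(xs ! i, xs ! Suc i) \<in> opairs A" if "Suc i < length xs" for i
    using that assms nth_mem[of i xs] nth_mem[of "Suc i" xs]
    by (auto simp: paths_def opairs_def successively_conv_nth)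
  ultimately show ?thesis unfolding path_strength_def by fastforce
qed

lemma finite_path_strengths:
  assumes "finite A"
  shows "finite (path_strength v ` paths A x y)"
proof (rule finite_subset)
  show "path_strength v ` paths A x y \<subseteq> v ` opairs A"
    by (intro image_subsetI) (rule path_strength_mem)
  show "finite (v ` opairs A)"
    using assms by (auto simp: opairs_def intro: finite_subset[of _ "A \<times> A"])
qed

lemma le_path_strength_iff:
  assumes "xs \<in> paths A x y"
  shows "c \<le> path_strength v xs \<longleftrightarrow> successively (\<lambda>a b. c \<le> v (a, b)) xs"
proof -
  have "Suc 0 < length xs" using assms by (simp add: paths_def)
  then have "{v (xs ! i, xs ! Suc i) | i. Suc i < length xs} \<noteq> {}" by blast
  then show ?thesis
    unfolding path_strength_def
    by (subst Min_ge_iff[OF finite_steps]) (auto simp: successively_conv_nth)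
qed

lemma le_indirect_score_iff:
  assumes "finite A" "(x, y) \<in> opairs A"
  shows "c \<le> indirect_score A v (x, y) \<longleftrightarrow>
    (\<exists>xs \<in> paths A x y. successively (\<lambda>a b. c \<le> v (a, b)) xs)"
proof -
  have "[x, y] \<in> paths A x y" using assms by (simp add: paths_def opairs_def)
  then have "path_strength v ` paths A x y \<noteq> {}" by blast
  then show ?thesis
    unfolding indirect_score_def
    by (simp add: Max_ge_iff[OF finite_path_strengths[OF assms(1)]] le_path_strength_iff
        cong: bex_cong)
qed

lemma indirect_score_trans:
  assumes "finite A" "(x, y) \<in> opairs A" "(y, z) \<in> opairs A" "(x, z) \<in> opairs A"
    and "c \<le> indirect_score A v (x, y)" "c \<le> indirect_score A v (y, z)"
  shows "c \<le> indirect_score A v (x, z)"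
proof -
  let ?P = "\<lambda>a b. c \<le> v (a, b)"
  from assms obtain xs ys where xs: "xs \<in> paths A x y" "successively ?P xs"
    and ys: "ys \<in> paths A y z" "successively ?P ys"
    by (auto simp: le_indirect_score_iff)
  obtain u us where us: "ys = y # u # us"
    using ys(1) by (cases ys; cases "tl ys") (auto simp: paths_def)
  have "xs \<noteq> []" using xs(1) by (auto simp: paths_def)
  then have "xs @ u # us \<in> paths A x z" "successively ?P (xs @ u # us)"
    using xs ys us by (auto simp: paths_def successively_append_iff)
  then show ?thesis using assms by (auto simp: le_indirect_score_iff)
qed

lemma indirect_comparison_trans:
  assumes "finite A"
  shows "trans (indirect_comparison A v)"
proof (rule transI)
  fix x y z
  assume "(x, y) \<in> indirect_comparison A v" "(y, z) \<in> indirect_comparison A v"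
  then have xy: "(x, y) \<in> opairs A" "(y, x) \<in> opairs A"
      "indirect_score A v (y, x) < indirect_score A v (x, y)"
    and yz: "(y, z) \<in> opairs A" "(z, y) \<in> opairs A"
      "indirect_score A v (z, y) < indirect_score A v (y, z)"
    by (auto simp: indirect_comparison_def indirect_margin_def opairs_def)
  have xz: "(x, z) \<in> opairs A" "(z, x) \<in> opairs A" using xy yz by (auto simp: opairs_def)
  note tr = indirect_score_trans[OF assms, of _ _ _ _ v]
  let ?s = "indirect_score A v"
  have "min (?s (x, y)) (?s (y, z)) \<le> ?s (x, z)"
    by (rule tr[OF xy(1) yz(1) xz(1)]) auto
  moreover have "min (?s (y, z)) (?s (z, x)) \<le> ?s (y, x)"
    by (rule tr[OF yz(1) xz(2) xy(2)]) auto
  moreover have "min (?s (z, x)) (?s (x, y)) \<le> ?s (z, y)"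
    by (rule tr[OF xz(2) xy(1) yz(2)]) auto
  ultimately have "?s (z, x) < ?s (x, z)" using xy(3) yz(3) by linarith
  then show "(x, z) \<in> indirect_comparison A v"
    using xz by (simp add: indirect_comparison_def indirect_margin_def)
qed

lemma admissible_order_exists:
  assumes "finite A"
  shows "\<exists>\<xi>. admissible_order A v \<xi>"
proof -
  let ?K = "indirect_comparison A v"
  define f where "f x = card {z. (z, x) \<in> ?K}" for x
  obtain g :: "'a \<Rightarrow> nat" where g: "inj_on g A"
    using finite_imp_inj_to_nat_seg[OF assms] by blast
  have K: "?K \<subseteq> opairs A" by (auto simp: indirect_comparison_def)
  have f_less: "f x < f y" if "(x, y) \<in> ?K" for x y
    unfolding f_def
  proof (rule psubset_card_mono)
    show "finite {z. (z, y) \<in> ?K}"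
      by (rule finite_subset[OF _ assms]) (use K in \<open>auto simp: opairs_def\<close>)
    have "x \<notin> {z. (z, x) \<in> ?K}" using K by (auto simp: opairs_def)
    then show "{z. (z, x) \<in> ?K} \<subset> {z. (z, y) \<in> ?K}"
      using that indirect_comparison_trans[OF assms, of v, THEN transD] by blast
  qed
  define \<xi> where "\<xi> = {(x, y) \<in> opairs A. f x < f y \<or> f x = f y \<and> g x < g y}"
  have "trans \<xi>"
    by (rule transI) (auto simp: \<xi>_def opairs_def)
  moreover have "total_on A \<xi>"
    using g by (auto simp: total_on_def \<xi>_def opairs_def inj_on_def) (metis linorder_neqE_nat)+
  moreover have "irrefl \<xi>" "\<xi> \<subseteq> opairs A" by (auto simp: irrefl_def \<xi>_def)
  moreover have "?K \<subseteq> \<xi>" using K f_less by (auto simp: \<xi>_def)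
  ultimately show ?thesis
    by (auto simp: admissible_order_def strict_linear_order_on_def)
qed

end

theory Submission
  imports Defs
begin

text \<open>
  Here \<open>v\<^sub>x\<^sub>y = (1 + \<alpha>\<^sub>x - \<alpha>\<^sub>y) / 2\<close>. A path all of whose links score at least \<open>c \<ge> 1/2\<close> descends in
  \<open>\<alpha>\<close> by at least \<open>2c - 1\<close> at each link, so the indirect margin of \<open>xy\<close> has the sign of
  \<open>\<alpha>\<^sub>x - \<alpha>\<^sub>y\<close>. Hence an admissible order sorts the options by decreasing \<open>\<alpha>\<close>, and a projected margin
  \<open>m\<^sup>\<sigma>\<close> between neighbours is positive where \<open>\<alpha>\<close> drops and zero where it does not. All turnouts being 1,
  the constant 1 is feasible in the quadratic programme and therefore its solution. Thus, for \<open>x\<close>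
  before \<open>y\<close>, the projected scores of \<open>xy\<close> and \<open>yx\<close> are \<open>1/2\<close> plus and minus half of the largest
  \<open>m\<^sup>\<sigma>\<close> between \<open>x\<close> and \<open>y\<close>, and the row of \<open>x\<close> dominates the row of \<open>y\<close>, strictly
  iff \<open>\<alpha>\<^sub>x > \<alpha>\<^sub>y\<close>.
\<close>

section \<open>Scores, paths and steps in general\<close>

lemma approval_margin_matrix_eq:
  assumes "finite A" "approval_profile A w"
  shows "approval_margin_matrix A w (x, y) = (1 + approval_score A w x - approval_score A w y) / 2"
proof -
  have f: "finite (Pow A)" using assms by simp
  have S: "(\<Sum>X | X \<subseteq> A \<and> P X. w X) = (\<Sum>X\<in>Pow A. if P X then w X else 0)" for P
    using sum.inter_filter[OF f, of w P] by (simp add: Pow_def)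
  \<comment> \<open>Subtraction-free form, checked vote by vote: the coefficient of
    \<open>w X\<close> is 2 on both sides if \<open>x\<close> is approved in \<open>X\<close>, and 1
    otherwise.\<close>
  have "2 * approval_margin_matrix A w (x, y) + approval_score A w y
      = (\<Sum>X\<in>Pow A. w X) + approval_score A w x"
    unfolding approval_margin_matrix_def approval_score_def
    by (simp add: S sum_distrib_left flip: sum.distrib) (intro sum.cong, auto)
  then show ?thesis using assms by (simp add: approval_profile_def)
qed

lemma indirect_score_mem:
  assumes "finite A" "(x, y) \<in> opairs A"
  shows "indirect_score A v (x, y) \<in> v ` opairs A"
proof -
  have "[x, y] \<in> paths A x y" using assms by (simp add: paths_def opairs_def)
  then have "indirect_score A v (x, y) \<in> path_strength v ` paths A x y"
    unfolding indirect_score_def using finite_path_strengths[OF assms(1)]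
    by (auto intro!: Max_in)
  then show ?thesis by (auto intro: path_strength_mem)
qed

lemma score_le_indirect_score:
  assumes "finite A" "(x, y) \<in> opairs A"
  shows "v (x, y) \<le> indirect_score A v (x, y)"
proof -
  have "[x, y] \<in> paths A x y" using assms by (simp add: paths_def opairs_def)
  then show ?thesis using assms by (auto simp: le_indirect_score_iff intro!: bexI[of _ "[x, y]"])
qed

text \<open>The differences telescope. One link already gives \<open>d\<close>, and each further
  link adds a nonnegative amount because \<open>0 \<le> d\<close>.\<close>

lemma successively_descent:
  fixes a :: "'a \<Rightarrow> real"
  assumes "successively (\<lambda>x y. d \<le> a x - a y) xs" "0 \<le> d" "2 \<le> length xs"
  shows "d \<le> a (hd xs) - a (last xs)"
  using assms
proof (induction xs rule: induct_list012)
  case (3 x y zs)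
  then show ?case by (cases zs) auto
qed auto

text \<open>Common index set of the \<open>Max\<close> for \<open>(x, y)\<close> and the
  \<open>Min\<close> for \<open>(y, x)\<close> in \<open>projected_score\<close>.\<close>

definition steps_between :: "'a rel \<Rightarrow> 'a \<Rightarrow> 'a \<Rightarrow> ('a \<times> 'a) set" where
  "steps_between r x y = {(p, p'). consecutive r p p' \<and> (x, p) \<in> r\<^sup>= \<and> (p, y) \<in> r}"

lemma Collect_pairs_eq_image:
  assumes "\<And>p q. Q p q \<Longrightarrow> f p q = g (p, q)"
  shows "{f p q | p q. Q p q} = g ` {(p, q). Q p q}"
  using assms by (auto simp: image_iff) metis+

text \<open>Membership of a consecutive pair depends only on its first option \<open>p\<close>, and
  \<open>y\<close> cuts the half-open interval from \<open>x\<close> to \<open>z\<close> in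
  two.\<close>

lemma steps_between_Un:
  assumes "trans r" "irrefl r" "total_on A r" "r \<subseteq> A \<times> A" "(x, y) \<in> r" "(y, z) \<in> r"
  shows "steps_between r x z = steps_between r x y \<union> steps_between r y z"
proof -
  have cut: "(x, p) \<in> r\<^sup>= \<and> (p, z) \<in> r \<longleftrightarrow>
      (x, p) \<in> r\<^sup>= \<and> (p, y) \<in> r \<or> (y, p) \<in> r\<^sup>= \<and> (p, z) \<in> r" for p
  proof -
    have "(p, y) \<in> r \<or> (y, p) \<in> r\<^sup>=" if "p \<in> A"
      using that assms(3,4,5) by (auto simp: total_on_def)
    then show ?thesis using assms by (auto dest: transD)
  qed
  show ?thesis unfolding steps_between_def using cut by blast
qed

locale approval_voting =
  fixes A :: "'a set" and w :: "'a set \<Rightarrow> real" and \<xi> :: "'a rel"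
  assumes finite_A: "finite A"
    and profile: "approval_profile A w"
    and admissible: "admissible_order A (approval_margin_matrix A w) \<xi>"
begin

abbreviation "\<alpha> \<equiv> approval_score A w"
abbreviation "v \<equiv> approval_margin_matrix A w"
abbreviation "m\<sigma> \<equiv> projected_margin A v \<xi>"
abbreviation "v\<pi> \<equiv> projected_score A v \<xi>"

lemmas v_eq = approval_margin_matrix_eq[OF finite_A profile]

lemma \<xi>_opairs: "\<xi> \<subseteq> opairs A" and \<xi>_trans: "trans \<xi>" and \<xi>_irrefl: "irrefl \<xi>"
  and \<xi>_total: "total_on A \<xi>" and \<xi>_sub: "\<xi> \<subseteq> A \<times> A"
  and comparison_sub: "indirect_comparison A v \<subseteq> \<xi>"
  using admissible by (auto simp: admissible_order_def strict_linear_order_on_def opairs_def)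

lemma finite_\<xi>: "finite \<xi>"
  using \<xi>_sub finite_A by (blast intro: finite_subset)

section \<open>Signs of the indirect margins\<close>

lemma indirect_score_descent:
  assumes "(x, y) \<in> opairs A" "1 / 2 \<le> c" "c \<le> indirect_score A v (x, y)"
  shows "2 * c - 1 \<le> \<alpha> x - \<alpha> y"
proof -
  obtain xs where xs: "xs \<in> paths A x y" "successively (\<lambda>a b. c \<le> v (a, b)) xs"
    using assms finite_A by (auto simp: le_indirect_score_iff)
  have "successively (\<lambda>a b. 2 * c - 1 \<le> \<alpha> a - \<alpha> b) xs"
    by (rule successively_mono[OF xs(2)]) (auto simp: v_eq field_simps)
  from successively_descent[OF this] show ?thesis
    using assms(2) xs(1) by (simp add: paths_def)
qed

lemma indirect_margin_pos:
  assumes "(x, y) \<in> opairs A" "\<alpha> y < \<alpha> x"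
  shows "0 < indirect_margin A v (x, y)"
proof -
  have yx: "(y, x) \<in> opairs A" using assms by (auto simp: opairs_def)
  have "1 / 2 < v (x, y)" using assms by (simp add: v_eq)
  \<comment> \<open>A path back from \<open>y\<close> to \<open>x\<close> of strength at least 1/2
    would never ascend in \<open>\<alpha>\<close>, against
    \<open>\<alpha> y < \<alpha> x\<close>.\<close>
  moreover have "indirect_score A v (y, x) < 1 / 2"
    using indirect_score_descent[OF yx, of "1 / 2"] assms(2) by fastforce
  ultimately show ?thesis
    using score_le_indirect_score[OF finite_A assms(1), of v]
    by (simp add: indirect_margin_def)
qed

lemma indirect_margin_zero:
  assumes "(x, y) \<in> opairs A" "\<alpha> x = \<alpha> y"
  shows "indirect_margin A v (x, y) = 0"
proof -
  have half: "indirect_score A v (a, b) = 1 / 2" if "(a, b) \<in> opairs A" "\<alpha> a = \<alpha> b" for a b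
  proof -
    have "1 / 2 \<le> indirect_score A v (a, b)"
      using score_le_indirect_score[OF finite_A that(1), of v] that(2) by (simp add: v_eq)
    \<comment> \<open>With \<open>c\<close> the indirect score itself, the descent bound reads
      \<open>2 * c - 1 \<le> 0\<close>.\<close>
    then show ?thesis
      using indirect_score_descent[OF that(1), of "indirect_score A v (a, b)"] that(2) by simp
  qed
  show ?thesis using half[of x y] half[of y x] assms
    by (auto simp: indirect_margin_def opairs_def)
qed

text \<open>An indirect score is one of the entries of \<open>v\<close>, so it lies in [0,1]. The
  bound makes the constant turnout 1 feasible.\<close>

lemma indirect_margin_le_1:
  assumes "(x, y) \<in> opairs A"
  shows "indirect_margin A v (x, y) \<le> 1"
proof -
  have yx: "(y, x) \<in> opairs A" using assms by (auto simp: opairs_def)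
  have "0 \<le> v p \<and> v p \<le> 1" if "p \<in> opairs A" for p
    using llull_matrix_approval_margin_matrix[OF finite_A profile] that
    by (auto simp: llull_matrix_def)
  then show ?thesis
    using indirect_score_mem[OF finite_A assms, of v]
      indirect_score_mem[OF finite_A yx, of v]
    unfolding indirect_margin_def by (smt (verit) case_prod_conv imageE)
qed

text \<open>If \<open>\<alpha>\<close> increased along \<open>\<xi>\<close>, the reversed pair would
  have a positive indirect margin and so belong to \<open>\<xi>\<close> as well.\<close>

lemma \<xi>_score_mono:
  assumes "(x, y) \<in> \<xi>\<^sup>="
  shows "\<alpha> y \<le> \<alpha> x"
proof (rule ccontr)
  assume less: "\<not> \<alpha> y \<le> \<alpha> x"
  then have "(x, y) \<in> \<xi>" using assms by auto
  then have "(y, x) \<in> opairs A" using \<xi>_opairs by (auto simp: opairs_def)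
  then have "(y, x) \<in> \<xi>"
    using indirect_margin_pos[of y x] less comparison_sub by (auto simp: indirect_comparison_def)
  then show False
    using \<open>(x, y) \<in> \<xi>\<close> \<xi>_trans \<xi>_irrefl by (meson irreflD transD)
qed

section \<open>Projected margins\<close>

lemma projected_margin_finite:
  assumes "(x, x') \<in> \<xi>"
  shows "finite {indirect_margin A v (p, q) | p q. (p, x) \<in> \<xi>\<^sup>= \<and> (x', q) \<in> \<xi>\<^sup>=}"
proof (rule finite_subset)
  show "{indirect_margin A v (p, q) | p q. (p, x) \<in> \<xi>\<^sup>= \<and> (x', q) \<in> \<xi>\<^sup>=}
      \<subseteq> indirect_margin A v ` (A \<times> A)"
    using assms \<xi>_sub by auto
qed (use finite_A in simp)

lemma projected_margin_le:
  assumes "(x, x') \<in> \<xi>"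
  shows "m\<sigma> (x, x') \<le> indirect_margin A v (x, x')"
  unfolding projected_margin_def using projected_margin_finite[OF assms] by (auto intro!: Min_le)

text \<open>The minimum is attained at some \<open>p\<close> weakly before \<open>x\<close> and
  \<open>q\<close> weakly after \<open>x'\<close>; monotonicity along \<open>\<xi>\<close> makes the
  gap in \<open>\<alpha>\<close> from \<open>p\<close> to \<open>q\<close> at least that from
  \<open>x\<close> to \<open>x'\<close>.\<close>

lemma projected_margin_obtain:
  assumes "(x, x') \<in> \<xi>"
  obtains p q where "(p, q) \<in> opairs A" "\<alpha> x \<le> \<alpha> p" "\<alpha> q \<le> \<alpha> x'"
    "m\<sigma> (x, x') = indirect_margin A v (p, q)"
proof -
  have "m\<sigma> (x, x') \<in> {indirect_margin A v (p, q) | p q. (p, x) \<in> \<xi>\<^sup>= \<and> (x', q) \<in> \<xi>\<^sup>=}"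
    unfolding projected_margin_def case_prod_conv
    by (rule Min_in[OF projected_margin_finite[OF assms]]) auto
  then obtain p q where pq: "(p, x) \<in> \<xi>\<^sup>=" "(x', q) \<in> \<xi>\<^sup>="
    "m\<sigma> (x, x') = indirect_margin A v (p, q)" by blast
  have "(p, q) \<in> \<xi>" using pq assms \<xi>_trans by (auto dest: transD)
  then show thesis using that pq \<xi>_score_mono \<xi>_opairs by blast
qed

lemma projected_margin_nonneg:
  assumes "(x, x') \<in> \<xi>"
  shows "0 \<le> m\<sigma> (x, x')"
proof -
  obtain p q where pq: "(p, q) \<in> opairs A" "\<alpha> x \<le> \<alpha> p" "\<alpha> q \<le> \<alpha> x'"
    "m\<sigma> (x, x') = indirect_margin A v (p, q)" using projected_margin_obtain[OF assms] .
  have "\<alpha> x' \<le> \<alpha> x" using assms \<xi>_score_mono by blast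
  then have "\<alpha> q < \<alpha> p \<or> \<alpha> p = \<alpha> q" using pq by linarith
  then show ?thesis using indirect_margin_pos indirect_margin_zero pq by fastforce
qed

lemma projected_margin_pos:
  assumes "(x, x') \<in> \<xi>" "\<alpha> x' < \<alpha> x"
  shows "0 < m\<sigma> (x, x')"
proof -
  obtain p q where "(p, q) \<in> opairs A" "\<alpha> x \<le> \<alpha> p" "\<alpha> q \<le> \<alpha> x'"
    "m\<sigma> (x, x') = indirect_margin A v (p, q)" using projected_margin_obtain[OF assms(1)] .
  then show ?thesis using indirect_margin_pos assms(2) by fastforce
qed

lemma projected_margin_zero:
  assumes "(x, x') \<in> \<xi>" "\<alpha> x = \<alpha> x'"
  shows "m\<sigma> (x, x') = 0"
  using projected_margin_le[OF assms(1)] projected_margin_nonneg[OF assms(1)]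
    indirect_margin_zero[of x x'] assms \<xi>_opairs by auto

lemma consecutiveD: "consecutive \<xi> x x' \<Longrightarrow> (x, x') \<in> \<xi>"
  by (simp add: consecutive_def)

section \<open>The quadratic programme\<close>

lemma projected_turnout_eq_1:
  "projected_turnout A v \<xi> = restrict (\<lambda>_. 1) (opairs A)"
proof -
  let ?t = "restrict (\<lambda>_. 1 :: real) (opairs A)"
  let ?f = "\<lambda>\<tau>. \<Sum>x\<in>A. \<Sum>y\<in>A - {x}. (\<tau> (x, y) - turnout v (x, y))\<^sup>2"
  have t1: "turnout v (x, y) = 1" for x y
    by (rule approval_margin_matrix_turnout[OF finite_A profile])
  have feasible: "?t \<in> feasible_turnouts A v \<xi>"
    unfolding feasible_turnouts_def
  proof (intro CollectI conjI allI impI ballI)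
    fix x x' assume c: "consecutive \<xi> x x'"
    then have \<xi>: "(x, x') \<in> \<xi>" and op: "(x, x') \<in> opairs A" using \<xi>_opairs consecutiveD by auto
    show "m\<sigma> (x, x') \<le> ?t (x, x')" "?t (x, x') \<le> 1"
      using op projected_margin_le[OF \<xi>] indirect_margin_le_1[OF op] by auto
    fix z assume "z \<in> A - {x, x'}"
    \<comment> \<open>Since \<open>z\<close> differs from \<open>x\<close> and \<open>x'\<close>,
      both pairs lie in \<open>opairs A\<close>, where \<open>?t\<close> is 1 and not
      \<open>undefined\<close>.\<close>
    then show "0 \<le> ?t (x, z) - ?t (x', z)" "?t (x, z) - ?t (x', z) \<le> m\<sigma> (x, x')"
      using op projected_margin_nonneg[OF \<xi>] by (auto simp: opairs_def)
  qed (auto simp: opairs_def)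
  have zero: "?f ?t = 0" by (intro sum.neutral ballI) (auto simp: t1 opairs_def)
  have nonneg: "0 \<le> ?f \<tau>" for \<tau> by (intro sum_nonneg) simp
  \<comment> \<open>A vanishing sum of squares fixes \<open>\<tau>\<close> on
    \<open>opairs A\<close>; extensionality fixes it elsewhere.\<close>
  have unique: "\<tau> = ?t" if "\<tau> \<in> feasible_turnouts A v \<xi>" "?f \<tau> = 0" for \<tau>
  proof (rule extensionalityI[of _ "opairs A"])
    show "\<tau> \<in> extensional (opairs A)" using that by (simp add: feasible_turnouts_def)
    fix p assume "p \<in> opairs A"
    then show "\<tau> p = ?t p"
      using that(2) finite_A
      by (auto simp: opairs_def t1 sum_nonneg_eq_0_iff sum_nonneg)
  qed simp
  show ?thesis
    unfolding projected_turnout_def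
  proof (rule the_equality)
    show "is_arg_min ?f (\<lambda>\<tau>. \<tau> \<in> feasible_turnouts A v \<xi>) ?t"
      using feasible zero nonneg by (simp add: is_arg_min_linorder)
    fix \<tau> assume "is_arg_min ?f (\<lambda>\<tau>. \<tau> \<in> feasible_turnouts A v \<xi>) \<tau>"
    then have "\<tau> \<in> feasible_turnouts A v \<xi>" "?f \<tau> \<le> ?f ?t"
      using feasible by (auto simp only: is_arg_min_linorder)
    then show "\<tau> = ?t" using unique zero nonneg[of \<tau>] by auto
  qed
qed

section \<open>Projected scores as extrema over steps\<close>

lemma projected_score_eq:
  assumes "(x, y) \<in> \<xi>"
  shows "v\<pi> (x, y) = Max ((\<lambda>s. (1 + m\<sigma> s) / 2) ` steps_between \<xi> x y)"
    and "v\<pi> (y, x) = Min ((\<lambda>s. (1 - m\<sigma> s) / 2) ` steps_between \<xi> x y)"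
proof -
  \<comment> \<open>Selects the \<open>Min\<close> branch of \<open>projected_score\<close> for
    \<open>(y, x)\<close>.\<close>
  have yx: "(y, x) \<notin> \<xi>" using assms \<xi>_trans \<xi>_irrefl by (meson irreflD transD)
  have t: "projected_turnout A v \<xi> (p, p') = 1" if "consecutive \<xi> p p'" for p p'
    using consecutiveD[OF that] \<xi>_opairs by (auto simp: projected_turnout_eq_1)
  have "{(projected_turnout A v \<xi> (p, p') + m\<sigma> (p, p')) / 2 | p p'.
      consecutive \<xi> p p' \<and> (x, p) \<in> \<xi>\<^sup>= \<and> (p, y) \<in> \<xi>}
      = (\<lambda>s. (1 + m\<sigma> s) / 2) ` steps_between \<xi> x y"
    unfolding steps_between_def by (rule Collect_pairs_eq_image) (simp add: t)
  then show "v\<pi> (x, y) = Max ((\<lambda>s. (1 + m\<sigma> s) / 2) ` steps_between \<xi> x y)"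
    using assms by (simp add: projected_score_def)
  have "{(projected_turnout A v \<xi> (p, p') - m\<sigma> (p, p')) / 2 | p p'.
      consecutive \<xi> p p' \<and> (x, p) \<in> \<xi>\<^sup>= \<and> (p, y) \<in> \<xi>}
      = (\<lambda>s. (1 - m\<sigma> s) / 2) ` steps_between \<xi> x y"
    unfolding steps_between_def by (rule Collect_pairs_eq_image) (simp add: t)
  then show "v\<pi> (y, x) = Min ((\<lambda>s. (1 - m\<sigma> s) / 2) ` steps_between \<xi> x y)"
    using yx by (simp add: projected_score_def)
qed

lemma steps_between_finite: "finite (steps_between \<xi> x y)"
  by (rule finite_subset[OF _ finite_\<xi>]) (auto simp: steps_between_def consecutive_def)

text \<open>The successor is a \<open>\<xi>\<close>-minimal option after \<open>x\<close>, which
  exists because a finite strict order is well-founded.\<close>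

lemma successor_exists:
  assumes "(x, y) \<in> \<xi>"
  obtains x' where "consecutive \<xi> x x'" "(x', y) \<in> \<xi>\<^sup>="
proof -
  have "wf \<xi>"
    using finite_\<xi> \<xi>_trans \<xi>_irrefl by (simp add: finite_acyclic_wf acyclic_irrefl)
  moreover have "y \<in> {z. (x, z) \<in> \<xi>}" using assms by simp
  ultimately obtain x' where x': "x' \<in> {z. (x, z) \<in> \<xi>}"
    "\<And>z. (z, x') \<in> \<xi> \<Longrightarrow> z \<notin> {z. (x, z) \<in> \<xi>}"
    by (rule wfE_min) blast
  have "x' \<in> A" "y \<in> A" using x'(1) assms \<xi>_sub by auto
  then have "(x', y) \<in> \<xi>\<^sup>="
    using x'(2)[of y] assms \<xi>_total by (auto simp: total_on_def)
  moreover have "consecutive \<xi> x x'" using x' by (auto simp: consecutive_def)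
  ultimately show thesis using that by blast
qed

lemma steps_between_nonempty:
  assumes "(x, y) \<in> \<xi>"
  shows "steps_between \<xi> x y \<noteq> {}"
proof -
  obtain x' where "consecutive \<xi> x x'" using successor_exists[OF assms] .
  then have "(x, x') \<in> steps_between \<xi> x y" using assms by (simp add: steps_between_def)
  then show ?thesis by blast
qed

text \<open>The step starts at the last option from \<open>x\<close> on, before \<open>y\<close>,
  whose \<open>\<alpha>\<close> still exceeds that of \<open>y\<close>.\<close>

lemma descending_step_exists:
  assumes "(x, y) \<in> \<xi>" "\<alpha> y < \<alpha> x"
  obtains p p' where "(p, p') \<in> steps_between \<xi> x y" "\<alpha> p' < \<alpha> p"
proof -
  let ?B = "{p. (x, p) \<in> \<xi>\<^sup>= \<and> (p, y) \<in> \<xi> \<and> \<alpha> y < \<alpha> p}"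
  have "wf (\<xi>\<inverse>)"
    using finite_\<xi> \<xi>_trans \<xi>_irrefl
    by (simp add: finite_acyclic_wf_converse acyclic_irrefl)
  moreover have "x \<in> ?B" using assms by simp
  ultimately obtain p where p: "p \<in> ?B" "\<And>z. (p, z) \<in> \<xi> \<Longrightarrow> z \<notin> ?B"
    by (rule wfE_min) blast
  then have "(p, y) \<in> \<xi>" by simp
  then obtain p' where p': "consecutive \<xi> p p'" "(p', y) \<in> \<xi>\<^sup>="
    using successor_exists by blast
  have "(x, p') \<in> \<xi>"
    using p(1) consecutiveD[OF p'(1)] \<xi>_trans by (auto dest: transD)
  \<comment> \<open>Either \<open>p' = y\<close>, or \<open>p'\<close> precedes \<open>y\<close> and
    can be missing from \<open>?B\<close> only through its \<open>\<alpha>\<close>.\<close>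
  then have "\<alpha> p' \<le> \<alpha> y"
    using p(2)[OF consecutiveD[OF p'(1)]] p'(2) by auto
  then show thesis using that[of p p'] p(1) p'(1) by (auto simp: steps_between_def)
qed

lemma projected_score_split:
  assumes "(x, y) \<in> \<xi>" "(y, z) \<in> \<xi>"
  shows "v\<pi> (x, z) = max (v\<pi> (x, y)) (v\<pi> (y, z))"
    and "v\<pi> (z, x) = min (v\<pi> (z, y)) (v\<pi> (y, x))"
proof -
  have xz: "(x, z) \<in> \<xi>" using assms \<xi>_trans by (auto dest: transD)
  note eqs = projected_score_eq[OF xz] projected_score_eq[OF assms(1)]
    projected_score_eq[OF assms(2)]
    steps_between_Un[OF \<xi>_trans \<xi>_irrefl \<xi>_total \<xi>_sub assms] image_Un
  show "v\<pi> (x, z) = max (v\<pi> (x, y)) (v\<pi> (y, z))"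
    unfolding eqs
    by (intro Max_Un) (simp_all add: steps_between_finite steps_between_nonempty assms)
  show "v\<pi> (z, x) = min (v\<pi> (z, y)) (v\<pi> (y, x))"
    unfolding eqs
    by (subst Min_Un) (simp_all add: steps_between_finite steps_between_nonempty assms min.commute)
qed

lemma step_in_\<xi>: "s \<in> steps_between \<xi> x y \<Longrightarrow> s \<in> \<xi>"
  by (auto simp: steps_between_def consecutive_def)

section \<open>Projected scores against 1/2, and comparison of rows\<close>

lemma projected_score_bounds:
  assumes "(x, y) \<in> \<xi>" "s \<in> steps_between \<xi> x y"
  shows "(1 + m\<sigma> s) / 2 \<le> v\<pi> (x, y)" "v\<pi> (y, x) \<le> (1 - m\<sigma> s) / 2"
  unfolding projected_score_eq[OF assms(1)]
  by (intro Max_ge Min_le finite_imageI steps_between_finite imageI assms(2))+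

lemma projected_score_half:
  assumes "(x, y) \<in> \<xi>"
  shows "1 / 2 \<le> v\<pi> (x, y)" "v\<pi> (y, x) \<le> 1 / 2"
proof -
  obtain s where s: "s \<in> steps_between \<xi> x y" using steps_between_nonempty[OF assms] by blast
  then have "0 \<le> m\<sigma> s" using projected_margin_nonneg step_in_\<xi> by (cases s) auto
  then show "1 / 2 \<le> v\<pi> (x, y)" "v\<pi> (y, x) \<le> 1 / 2"
    using projected_score_bounds[OF assms s] by auto
qed

lemma projected_score_strict:
  assumes "(x, y) \<in> \<xi>" "\<alpha> y < \<alpha> x"
  shows "1 / 2 < v\<pi> (x, y)"
proof -
  obtain p p' where s: "(p, p') \<in> steps_between \<xi> x y" "\<alpha> p' < \<alpha> p"
    using descending_step_exists[OF assms] .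
  then have "0 < m\<sigma> (p, p')" using projected_margin_pos step_in_\<xi> by blast
  then show ?thesis
    using projected_score_bounds(1)[OF assms(1) s(1)] by simp
qed

lemma projected_score_tie:
  assumes "(x, y) \<in> \<xi>" "\<alpha> x = \<alpha> y"
  shows "v\<pi> (x, y) = 1 / 2" "v\<pi> (y, x) = 1 / 2"
proof -
  have "m\<sigma> s = 0" if s: "s \<in> steps_between \<xi> x y" for s
  proof -
    obtain p p' where pp': "s = (p, p')" "consecutive \<xi> p p'" "(x, p) \<in> \<xi>\<^sup>=" "(p, y) \<in> \<xi>"
      using s by (auto simp: steps_between_def)
    have "p' \<in> A" "y \<in> A" using consecutiveD[OF pp'(2)] assms(1) \<xi>_sub by auto
    \<comment> \<open>Otherwise \<open>y\<close> would lie strictly between the consecutive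
      \<open>p\<close> and \<open>p'\<close>. Hence \<open>\<alpha>\<close> at \<open>p\<close> and
      \<open>p'\<close> is squeezed between two equal values.\<close>
    then have "(p', y) \<in> \<xi>\<^sup>="
      using pp'(2,4) \<xi>_total by (auto simp: consecutive_def total_on_def)
    then have "\<alpha> p = \<alpha> p'"
      using \<xi>_score_mono[OF pp'(3)] \<xi>_score_mono[of p p'] \<xi>_score_mono[of p' y]
        consecutiveD[OF pp'(2)] assms(2) by auto
    then show ?thesis using projected_margin_zero consecutiveD[OF pp'(2)] pp'(1) by simp
  qed
  then have "(\<lambda>s. (1 + m\<sigma> s) / 2) ` steps_between \<xi> x y = {1 / 2}"
    "(\<lambda>s. (1 - m\<sigma> s) / 2) ` steps_between \<xi> x y = {1 / 2}"
    using steps_between_nonempty[OF assms(1)] by auto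
  then show "v\<pi> (x, y) = 1 / 2" "v\<pi> (y, x) = 1 / 2"
    by (simp_all add: projected_score_eq[OF assms(1)])
qed

text \<open>By position of \<open>z\<close>: before \<open>x\<close>, the entry of \<open>y\<close>
  is a minimum that includes the entry of \<open>x\<close>; between them, 1/2 separates the entries;
  after \<open>y\<close>, the entry of \<open>x\<close> is a maximum that includes the entry of
  \<open>y\<close>. In a tie the other term of the minimum or maximum is 1/2 and has no
  effect.\<close>

lemma projected_score_row:
  assumes "(x, y) \<in> \<xi>" "z \<in> A" "z \<noteq> x" "z \<noteq> y"
  shows "v\<pi> (y, z) \<le> v\<pi> (x, z)" "\<alpha> x = \<alpha> y \<Longrightarrow> v\<pi> (y, z) = v\<pi> (x, z)"
proof -
  have "x \<in> A" "y \<in> A" using assms \<xi>_sub by auto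
  then consider "(z, x) \<in> \<xi>" | "(x, z) \<in> \<xi>" "(z, y) \<in> \<xi>" | "(y, z) \<in> \<xi>"
    using \<xi>_total assms by (metis total_on_def)
  then have "v\<pi> (y, z) \<le> v\<pi> (x, z) \<and> (\<alpha> x = \<alpha> y \<longrightarrow> v\<pi> (y, z) = v\<pi> (x, z))"
  proof cases
    case 1
    show ?thesis
      using projected_score_split(2)[OF 1 assms(1)] projected_score_tie(2)[OF assms(1)]
        projected_score_half(2)[OF 1] by auto
  next
    case 2
    show ?thesis
      using projected_score_half(1)[OF 2(1)] projected_score_half(2)[OF 2(2)]
        projected_score_tie(1)[OF 2(1)] projected_score_tie(2)[OF 2(2)]
        \<xi>_score_mono[of x z] \<xi>_score_mono[of z y] 2 by auto
  next
    case 3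
    show ?thesis
      using projected_score_split(1)[OF assms(1) 3] projected_score_tie(1)[OF assms(1)]
        projected_score_half(1)[OF 3] by auto
  qed
  then show "v\<pi> (y, z) \<le> v\<pi> (x, z)" "\<alpha> x = \<alpha> y \<Longrightarrow> v\<pi> (y, z) = v\<pi> (x, z)" by auto
qed

section \<open>Comparison of the rates\<close>

lemma rank_like_rate_split:
  assumes "x \<in> A" "y \<in> A" "x \<noteq> y"
  shows "rank_like_rate A v \<xi> x = real (card A) - (v\<pi> (x, y) + (\<Sum>z\<in>A - {x, y}. v\<pi> (x, z)))"
proof -
  have "A - {x} - {y} = A - {x, y}" by auto
  then show ?thesis
    using assms finite_A
    by (simp add: rank_like_rate_def sum.remove[of "A - {x}" y])
qed

lemma rank_like_rate_order:
  assumes "(x, y) \<in> \<xi>"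
  shows "\<alpha> y < \<alpha> x \<Longrightarrow> rank_like_rate A v \<xi> x < rank_like_rate A v \<xi> y"
    and "\<alpha> x = \<alpha> y \<Longrightarrow> rank_like_rate A v \<xi> x = rank_like_rate A v \<xi> y"
proof -
  have A: "x \<in> A" "y \<in> A" "x \<noteq> y" using assms \<xi>_opairs by (auto simp: opairs_def)
  have "{y, x} = {x, y}" by auto
  note split = rank_like_rate_split[OF A] rank_like_rate_split[OF A(2,1) A(3)[symmetric]] this
  have "(\<Sum>z\<in>A - {x, y}. v\<pi> (y, z)) \<le> (\<Sum>z\<in>A - {x, y}. v\<pi> (x, z))"
    using projected_score_row(1)[OF assms] by (intro sum_mono) auto
  \<comment> \<open>Strictness comes from the mutual entries alone: \<open>v\<pi> (x, y)\<close>
    exceeds 1/2 and \<open>v\<pi> (y, x)\<close> does not.\<close>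
  then show "rank_like_rate A v \<xi> x < rank_like_rate A v \<xi> y" if "\<alpha> y < \<alpha> x"
    unfolding split
    using projected_score_strict[OF assms that] projected_score_half(2)[OF assms] by linarith
  show "rank_like_rate A v \<xi> x = rank_like_rate A v \<xi> y" if "\<alpha> x = \<alpha> y"
  proof -
    have "(\<Sum>z\<in>A - {x, y}. v\<pi> (y, z)) = (\<Sum>z\<in>A - {x, y}. v\<pi> (x, z))"
      using projected_score_row(2)[OF assms _ _ _ that] by (intro sum.cong) auto
    then show ?thesis unfolding split using projected_score_tie[OF assms that] by simp
  qed
qed

text \<open>As \<open>\<xi>\<close> may order tied options either way, each direction of
  \<open>\<xi>\<close> calls for both the strict and the equality case.\<close>

lemma rank_like_rate_less_iff:
  assumes "x \<in> A" "y \<in> A"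
  shows "rank_like_rate A v \<xi> x < rank_like_rate A v \<xi> y \<longleftrightarrow> \<alpha> x > \<alpha> y"
proof -
  consider "x = y" | "(x, y) \<in> \<xi>" | "(y, x) \<in> \<xi>"
    using assms \<xi>_total by (auto simp: total_on_def)
  then show ?thesis
  proof cases
    case 2
    then show ?thesis using rank_like_rate_order[OF 2] \<xi>_score_mono[of x y] by fastforce
  next
    case 3
    then show ?thesis using rank_like_rate_order[OF 3] \<xi>_score_mono[of y x] by fastforce
  qed simp
qed

end

theorem theorem9p3:
  fixes A :: "'a set" and w :: "'a set \<Rightarrow> real" and \<xi> :: "'a rel" and x y :: 'a
  assumes "finite A"
    and "approval_profile A w"
    and "admissible_order A (approval_margin_matrix A w) \<xi>"
    and "x \<in> A" and "y \<in> A"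
  shows "rank_like_rate A (approval_margin_matrix A w) \<xi> x
           < rank_like_rate A (approval_margin_matrix A w) \<xi> y
         \<longleftrightarrow> approval_score A w x > approval_score A w y"
proof -
  interpret approval_voting A w \<xi> using assms by unfold_locales
  show ?thesis using assms(4,5) by (rule rank_like_rate_less_iff)
qed

end
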